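(* Let $a>0$ and let $\Omega_a=\{(x_1,x_2,0): -a<x_1<a\}$ be a strip of the $(x_1,x_2)$-plane. Given constants $\kappa>0$ and $\beta\in\mathbb{R}$, there exists a stationary band $S=\{(r,x_2,u(r)): -a<r<a,\ x_2\in\mathbb{R}\}$ on $\Omega_a$, with mean curvature satisfying $2H=\kappa x_3$, whose directrix is defined by a function $u=u(\cdot;u_0)$ for some $u_0\in\mathbb{R}$, and that makes a contact hyperbolic angle $\beta$ with the support plane $\{x_3=u(a)\}$ along its boundary.
   Context: $\mathbb{L}^3$ is $\mathbb{R}^3$ with the Lorentzian metric $dx_1^2+dx_2^2-dx_3^2$. For a surface $S=\{(r,x_2,u(r))\}$ that is spacelike (i.e. $|u'|<1$), oriented by the unit normal $N$ in the same time-orientation as $(0,0,1)$, the mean curvature $H$ satisfies $2H=\dfrac{u''}{(1-u'^2)^{3/2}}$; thus the condition $2H=\kappa x_3$ on $S$ reads $\dfrac{u''(r)}{(1-u'(r)^2)^{3/2}}=\kappa u(r)$ for $-a<r<a$. Such a surface is called a stationary band on $\Omega_a$ (with capillary constant $\kappa$). The condition that $S$ makes contact hyperbolic angle $\beta$ with the plane $\{x_3=u(a)\}$ along its boundary reads $u'(\pm a)=\pm\tanh\beta$. For $u_0\in\mathbb{R}$, $u(\cdot;u_0)$ denotes the unique solution, defined on all of $\mathbb{R}$, of $\dfrac{u''}{(1-u'^2)^{3/2}}=\kappa u$ with $u(0)=u_0$, $u'(0)=0$, $|u'|<1$. *)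

theory Defs
  imports "HOL-Analysis.Analysis"
begin

section \<open>Spacelike surfaces in Lorentz-Minkowski space\<close>

definition lorentz :: "real^3 \<Rightarrow> real^3 \<Rightarrow> real" where
  "lorentz v w = v$1 * w$1 + v$2 * w$2 - v$3 * w$3"

definition partial1 :: "(real \<Rightarrow> real \<Rightarrow> real^3) \<Rightarrow> real \<Rightarrow> real \<Rightarrow> real^3" where
  "partial1 X r s = vector_derivative (\<lambda>t. X t s) (at r)"

definition partial2 :: "(real \<Rightarrow> real \<Rightarrow> real^3) \<Rightarrow> real \<Rightarrow> real \<Rightarrow> real^3" where
  "partial2 X r s = vector_derivative (\<lambda>t. X r t) (at s)"

text \<open>The induced metric is positive definite; in particular the two partial derivatives are
  linearly independent.\<close>

definition spacelike_at :: "(real \<Rightarrow> real \<Rightarrow> real^3) \<Rightarrow> real \<Rightarrow> real \<Rightarrow> bool" where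
  "spacelike_at X r s \<longleftrightarrow>
     (\<forall>x y. (x, y) \<noteq> (0, 0) \<longrightarrow>
        (let v = x *\<^sub>R partial1 X r s + y *\<^sub>R partial2 X r s in lorentz v v > 0))"

text \<open>Two timelike vectors have the same time orientation iff their product is negative. The
  description is meaningful only where \<open>X\<close> is spacelike.\<close>

definition is_future_unit_normal ::
    "(real \<Rightarrow> real \<Rightarrow> real^3) \<Rightarrow> real \<Rightarrow> real \<Rightarrow> real^3 \<Rightarrow> bool" where
  "is_future_unit_normal X r s n \<longleftrightarrow>
     lorentz n n = - 1 \<and> lorentz n (partial1 X r s) = 0 \<and> lorentz n (partial2 X r s) = 0 \<and>
     lorentz n (vector [0, 0, 1]) < 0"

definition future_unit_normal :: "(real \<Rightarrow> real \<Rightarrow> real^3) \<Rightarrow> real \<Rightarrow> real \<Rightarrow> real^3" where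
  "future_unit_normal X r s = (THE n. is_future_unit_normal X r s n)"

text \<open>The second fundamental form \<open>h\<close> is the normal component of the second derivatives:
  \<open>X\<^sub>i\<^sub>j = tangential + h\<^sub>i\<^sub>j N\<close>. As \<open>N\<close> is timelike, \<open>h\<^sub>i\<^sub>j = - \<langle>N, X\<^sub>i\<^sub>j\<rangle>\<close>. With
  this sign an upward convex profile has positive mean curvature.\<close>

definition mean_curvature :: "(real \<Rightarrow> real \<Rightarrow> real^3) \<Rightarrow> real \<Rightarrow> real \<Rightarrow> real" where
  "mean_curvature X r s =
     (let N = future_unit_normal X r s;
          E = lorentz (partial1 X r s) (partial1 X r s);
          F = lorentz (partial1 X r s) (partial2 X r s);
          G = lorentz (partial2 X r s) (partial2 X r s);
          e = - lorentz N (partial1 (partial1 X) r s);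
          f = - lorentz N (partial2 (partial1 X) r s);
          g = - lorentz N (partial2 (partial2 X) r s)
      in (e * G - 2 * f * F + g * E) / (2 * (E * G - F\<^sup>2)))"


section \<open>Stationary bands\<close>

definition strip :: "real \<Rightarrow> (real^3) set" where
  "strip a = {p. - a < p$1 \<and> p$1 < a \<and> p$3 = 0}"

definition band_chart :: "(real \<Rightarrow> real) \<Rightarrow> real \<Rightarrow> real \<Rightarrow> real^3" where
  "band_chart u r s = vector [r, s, u r]"

definition band :: "real \<Rightarrow> (real \<Rightarrow> real) \<Rightarrow> (real^3) set" where
  "band a u = (\<lambda>p. band_chart u (p$1) (p$2)) ` strip a"

definition C2_on :: "real set \<Rightarrow> (real \<Rightarrow> real) \<Rightarrow> bool" where
  "C2_on A u \<longleftrightarrow>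
     (\<forall>r\<in>A. u differentiable (at r)) \<and> (\<forall>r\<in>A. deriv u differentiable (at r)) \<and>
     continuous_on A (deriv (deriv u))"

definition stationary_band :: "real \<Rightarrow> real \<Rightarrow> (real \<Rightarrow> real) \<Rightarrow> (real^3) set \<Rightarrow> bool" where
  "stationary_band \<kappa> a u S \<longleftrightarrow>
     S = band a u \<and> C2_on {- a <..< a} u \<and>
     (\<forall>p\<in>S. spacelike_at (band_chart u) (p$1) (p$2) \<and>
            2 * mean_curvature (band_chart u) (p$1) (p$2) = \<kappa> * p$3)"

text \<open>The boundary of the band consists of the lines over \<open>r = a\<close> and \<open>r = - a\<close>, at which
  the outward unit conormal of the strip is \<open>(1, 0, 0)\<close> and \<open>(- 1, 0, 0)\<close>, respectively; the
  future unit normal of the support plane is \<open>(0, 0, 1)\<close>. The angle is signed: besides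
  \<open>cosh \<beta> = - \<langle>N, (0, 0, 1)\<rangle>\<close>, the component of \<open>N\<close> along the outward conormal
  has to be \<open>sinh \<beta>\<close>.\<close>

definition makes_contact_angle :: "real \<Rightarrow> (real \<Rightarrow> real) \<Rightarrow> real \<Rightarrow> bool" where
  "makes_contact_angle a u \<beta> \<longleftrightarrow>
     u differentiable (at a) \<and> u differentiable (at (- a)) \<and>
     (\<forall>\<epsilon>\<in>{1, - 1}. \<forall>s.
        band_chart u (\<epsilon> * a) s \<in> {p. p$3 = u a} \<and>
        spacelike_at (band_chart u) (\<epsilon> * a) s \<and>
        future_unit_normal (band_chart u) (\<epsilon> * a) s =
          cosh \<beta> *\<^sub>R vector [0, 0, 1] + sinh \<beta> *\<^sub>R vector [\<epsilon>, 0, 0])"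

text \<open>\<open>u\<close> is \<open>u(\<cdot>; u\<^sub>0)\<close>, the solution on the whole line.\<close>

definition is_profile :: "real \<Rightarrow> real \<Rightarrow> (real \<Rightarrow> real) \<Rightarrow> bool" where
  "is_profile \<kappa> u0 u \<longleftrightarrow>
     u 0 = u0 \<and> deriv u 0 = 0 \<and>
     (\<forall>r. u differentiable (at r) \<and> deriv u differentiable (at r) \<and> \<bar>deriv u r\<bar> < 1 \<and>
          deriv (deriv u) r / (1 - (deriv u r)\<^sup>2) powr (3/2) = \<kappa> * u r)"


section \<open>The geometric conditions in terms of the profile\<close>

lemma vector3_decomp:
  "(vector [x, y, z] :: real^3) = x *\<^sub>R axis 1 1 + y *\<^sub>R axis 2 1 + z *\<^sub>R axis 3 1"
  by (simp add: vec_eq_iff forall_3 axis_def)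

lemma has_vector_derivative_vector3:
  assumes "(f has_real_derivative f') (at r)" "(g has_real_derivative g') (at r)"
    "(h has_real_derivative h') (at r)"
  shows "((\<lambda>t. vector [f t, g t, h t] :: real^3) has_vector_derivative vector [f', g', h']) (at r)"
  unfolding vector3_decomp
  using assms by (auto intro!: derivative_eq_intros simp: has_real_derivative_iff_has_vector_derivative)

lemma real_differentiable_deriv:
  fixes u :: "real \<Rightarrow> real"
  assumes "u differentiable (at r)"
  shows "(u has_real_derivative deriv u r) (at r)"
  using assms by (simp add: DERIV_deriv_iff_real_differentiable)

lemma partial1_band_chart:
  assumes "u differentiable (at r)"
  shows "partial1 (band_chart u) r s = vector [1, 0, deriv u r]"
  unfolding partial1_def band_chart_def
  by (intro vector_derivative_at has_vector_derivative_vector3 real_differentiable_deriv assms)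
     (auto intro!: derivative_eq_intros)

lemma partial2_band_chart: "partial2 (band_chart u) r s = vector [0, 1, 0]"
  unfolding partial2_def band_chart_def
  by (intro vector_derivative_at has_vector_derivative_vector3) (auto intro!: derivative_eq_intros)

lemma spacelike_at_band_chart_iff:
  assumes "u differentiable (at r)"
  shows "spacelike_at (band_chart u) r s \<longleftrightarrow> \<bar>deriv u r\<bar> < 1"
proof -
  let ?d = "deriv u r"
  have eq: "spacelike_at (band_chart u) r s \<longleftrightarrow>
      (\<forall>x y. (x, y) \<noteq> (0, 0) \<longrightarrow> x\<^sup>2 * (1 - ?d\<^sup>2) + y\<^sup>2 > 0)"
    by (simp add: spacelike_at_def partial1_band_chart[OF assms] partial2_band_chart lorentz_def
        power2_eq_square algebra_simps)
  show ?thesis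
  proof
    assume "spacelike_at (band_chart u) r s"
    then have "(1::real)\<^sup>2 * (1 - ?d\<^sup>2) + 0\<^sup>2 > 0"
      unfolding eq by (metis one_neq_zero prod.inject)
    then show "\<bar>?d\<bar> < 1" by (simp add: abs_square_less_1)
  next
    assume "\<bar>?d\<bar> < 1"
    then have d: "1 - ?d\<^sup>2 > 0" by (simp add: abs_square_less_1)
    show "spacelike_at (band_chart u) r s"
      unfolding eq
    proof (intro allI impI)
      fix x y :: real assume xy: "(x, y) \<noteq> (0, 0)"
      show "x\<^sup>2 * (1 - ?d\<^sup>2) + y\<^sup>2 > 0"
      proof (cases "x = 0")
        case True with xy show ?thesis by simp
      next
        case False
        then have "x\<^sup>2 * (1 - ?d\<^sup>2) > 0" using d by simp
        then show ?thesis by (simp add: add_pos_nonneg)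
      qed
    qed
  qed
qed

lemma future_unit_normal_band_chart:
  assumes "u differentiable (at r)" and less: "\<bar>deriv u r\<bar> < 1"
  shows "future_unit_normal (band_chart u) r s =
    (1 / sqrt (1 - (deriv u r)\<^sup>2)) *\<^sub>R vector [deriv u r, 0, 1]"
proof -
  let ?d = "deriv u r" and ?w = "sqrt (1 - (deriv u r)\<^sup>2)"
  have d: "1 - ?d\<^sup>2 > 0" using less by (simp add: abs_square_less_1)
  then have w: "?w > 0" "?w\<^sup>2 = 1 - ?d\<^sup>2" by auto
  have iff: "is_future_unit_normal (band_chart u) r s n \<longleftrightarrow>
      (n$1)\<^sup>2 + (n$2)\<^sup>2 - (n$3)\<^sup>2 = -1 \<and> n$1 = n$3 * ?d \<and> n$2 = 0 \<and> n$3 > 0" for n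
    by (simp add: is_future_unit_normal_def partial1_band_chart[OF assms(1)] partial2_band_chart
        lorentz_def power2_eq_square)
  show ?thesis
    unfolding future_unit_normal_def
  proof (rule the_equality)
    show "is_future_unit_normal (band_chart u) r s ((1 / ?w) *\<^sub>R vector [?d, 0, 1])"
      unfolding iff using w d
      by (auto simp: power_divide divide_simps)
  next
    fix n assume "is_future_unit_normal (band_chart u) r s n"
    then have n: "(n$1)\<^sup>2 + (n$2)\<^sup>2 - (n$3)\<^sup>2 = -1" "n$1 = n$3 * ?d" "n$2 = 0" "n$3 > 0"
      using iff by blast+
    from n(1) have "(n$3)\<^sup>2 * ?w\<^sup>2 = 1"
      unfolding w(2) n(2,3) by (simp add: power_mult_distrib algebra_simps)
    then have "(n$3 * ?w)\<^sup>2 = 1\<^sup>2" by (simp only: power_mult_distrib power_one)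
    then have "n$3 * ?w = 1"
      using n(4) w(1) by (metis mult_pos_pos order_less_imp_le power2_eq_imp_eq zero_le_one)
    then have n3: "n$3 = 1 / ?w" using w(1) by (simp add: field_simps)
    show "n = (1 / ?w) *\<^sub>R vector [?d, 0, 1]"
      unfolding vec_eq_iff forall_3 using n(2,3) n3 by simp
  qed
qed

lemma mean_curvature_band_chart:
  assumes A: "open A" "r \<in> A" and diff: "\<And>x. x \<in> A \<Longrightarrow> u differentiable (at x)"
    and diff2: "deriv u differentiable (at r)" and less: "\<bar>deriv u r\<bar> < 1"
  shows "2 * mean_curvature (band_chart u) r s =
    deriv (deriv u) r / (1 - (deriv u r)\<^sup>2) powr (3/2)"
proof -
  let ?X = "band_chart u" and ?d = "deriv u r" and ?w = "sqrt (1 - (deriv u r)\<^sup>2)"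
  have d: "1 - ?d\<^sup>2 > 0" using less by (simp add: abs_square_less_1)
  then have w: "?w > 0" "?w * ?w = 1 - ?d\<^sup>2" by auto
  have pw: "(1 - ?d\<^sup>2) powr (3/2) = (1 - ?d\<^sup>2) * ?w"
    using powr_add[of "1 - ?d\<^sup>2" 1 "1/2"] d by (simp add: powr_half_sqrt)
  have "((\<lambda>t. vector [1, 0, deriv u t] :: real^3) has_vector_derivative
      vector [0, 0, deriv (deriv u) r]) (at r)"
    by (intro has_vector_derivative_vector3 real_differentiable_deriv diff2)
       (auto intro!: derivative_eq_intros)
  then have "((\<lambda>t. partial1 ?X t s) has_vector_derivative vector [0, 0, deriv (deriv u) r]) (at r)"
    by (rule has_vector_derivative_transform_within_open[OF _ A])
       (simp add: partial1_band_chart diff)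
  then have p11: "partial1 (partial1 ?X) r s = vector [0, 0, deriv (deriv u) r]"
    unfolding partial1_def[of "partial1 ?X"] by (rule vector_derivative_at)
  have p12: "partial2 (partial1 ?X) r s = 0"
    unfolding partial2_def[of "partial1 ?X"] partial1_band_chart[OF diff[OF A(2)]] by simp
  have p22: "partial2 (partial2 ?X) r s = 0"
    unfolding partial2_def[of "partial2 ?X"] partial2_band_chart by simp
  have "2 * mean_curvature ?X r s = deriv (deriv u) r / ?w / (1 - ?d\<^sup>2)"
    unfolding mean_curvature_def Let_def p11 p12 p22 partial2_band_chart
      partial1_band_chart[OF diff[OF A(2)]]
      future_unit_normal_band_chart[OF diff[OF A(2)] less]
    using d w(1) by (simp add: lorentz_def power2_eq_square divide_simps) (simp add: algebra_simps)?
  then show ?thesis unfolding pw by (simp add: mult.commute)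
qed

lemma stationary_band_iff:
  "stationary_band \<kappa> a u (band a u) \<longleftrightarrow>
    C2_on {- a <..< a} u \<and>
    (\<forall>r. - a < r \<and> r < a \<longrightarrow> \<bar>deriv u r\<bar> < 1 \<and>
       deriv (deriv u) r / (1 - (deriv u r)\<^sup>2) powr (3/2) = \<kappa> * u r)"
proof -
  have ball: "(\<forall>p\<in>band a u. P (p$1) (p$2) (p$3)) \<longleftrightarrow>
      (\<forall>r s. - a < r \<and> r < a \<longrightarrow> P r s (u r))" (is "?l \<longleftrightarrow> ?r") for P
  proof
    assume l: ?l
    show ?r
    proof (intro allI impI)
      fix r s assume "- a < r \<and> r < a"
      then have "(vector [r, s, 0] :: real^3) \<in> strip a" by (simp add: strip_def)
      from imageI[OF this, of "\<lambda>p. band_chart u (p$1) (p$2)"]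
      have "band_chart u r s \<in> band a u" by (simp add: band_def)
      from bspec[OF l this] show "P r s (u r)" by (simp add: band_chart_def)
    qed
  qed (auto simp: band_def strip_def band_chart_def)
  have eq: "stationary_band \<kappa> a u (band a u) \<longleftrightarrow> C2_on {- a <..< a} u \<and>
      (\<forall>r s. - a < r \<and> r < a \<longrightarrow> spacelike_at (band_chart u) r s \<and>
         2 * mean_curvature (band_chart u) r s = \<kappa> * u r)"
    unfolding stationary_band_def
    using ball[of "\<lambda>r s z. spacelike_at (band_chart u) r s \<and>
      2 * mean_curvature (band_chart u) r s = \<kappa> * z"] by simp
  have "(spacelike_at (band_chart u) r s \<and> 2 * mean_curvature (band_chart u) r s = \<kappa> * u r) \<longleftrightarrow>
      (\<bar>deriv u r\<bar> < 1 \<and> deriv (deriv u) r / (1 - (deriv u r)\<^sup>2) powr (3/2) = \<kappa> * u r)"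
    if "C2_on {- a <..< a} u" "- a < r \<and> r < a" for r s
    using that mean_curvature_band_chart[of "{- a <..< a}" r u s]
      spacelike_at_band_chart_iff[of u r s]
    unfolding C2_on_def by auto
  then show ?thesis unfolding eq by meson
qed

lemma normal_angle_iff:
  fixes d \<beta> \<epsilon> :: real
  assumes "\<bar>d\<bar> < 1" and e: "\<epsilon> = 1 \<or> \<epsilon> = - 1"
  shows "(1 / sqrt (1 - d\<^sup>2)) *\<^sub>R (vector [d, 0, 1] :: real^3) =
      cosh \<beta> *\<^sub>R vector [0, 0, 1] + sinh \<beta> *\<^sub>R vector [\<epsilon>, 0, 0] \<longleftrightarrow> d = \<epsilon> * tanh \<beta>"
proof -
  let ?w = "sqrt (1 - d\<^sup>2)"
  have w: "?w > 0" using assms(1) by (simp add: abs_square_less_1)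
  have c: "cosh \<beta> > 0" by (rule cosh_real_pos)
  have "(1 / ?w) *\<^sub>R (vector [d, 0, 1] :: real^3) =
      cosh \<beta> *\<^sub>R vector [0, 0, 1] + sinh \<beta> *\<^sub>R vector [\<epsilon>, 0, 0] \<longleftrightarrow>
      d / ?w = sinh \<beta> * \<epsilon> \<and> 1 / ?w = cosh \<beta>" (is "?L \<longleftrightarrow> ?M")
    by (auto simp: vec_eq_iff forall_3)
  also have "\<dots> \<longleftrightarrow> d = \<epsilon> * tanh \<beta>"
  proof
    assume ?M
    then have "d * cosh \<beta> = sinh \<beta> * \<epsilon>" by (metis mult.right_neutral times_divide_eq_right)
    then show "d = \<epsilon> * tanh \<beta>" using c by (simp add: tanh_def field_simps)
  next
    assume d: "d = \<epsilon> * tanh \<beta>"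
    have e2: "\<epsilon>\<^sup>2 = 1" using e by auto
    have "(sinh \<beta>)\<^sup>2 + 1 \<noteq> 0" by (metis add_nonneg_pos less_irrefl zero_le_power2 zero_less_one)
    then have "1 - d\<^sup>2 = (1 / cosh \<beta>)\<^sup>2"
      using c cosh_square_eq[of \<beta>] unfolding d tanh_def power_mult_distrib e2 power_divide
      by (simp add: divide_simps)
    then have "?w = 1 / cosh \<beta>" using c by simp
    then show ?M using c d by (simp add: tanh_def)
  qed
  finally show ?thesis .
qed

lemma makes_contact_angle_iff:
  "makes_contact_angle a u \<beta> \<longleftrightarrow>
     u differentiable (at a) \<and> u differentiable (at (- a)) \<and>
     u (- a) = u a \<and> deriv u a = tanh \<beta> \<and> deriv u (- a) = - tanh \<beta>"
proof (cases "u differentiable (at a) \<and> u differentiable (at (- a))")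
  case True
  have t: "\<bar>tanh \<beta>\<bar> < 1" using tanh_real_bounds[of \<beta>] by auto
  have "(spacelike_at (band_chart u) r s \<and> future_unit_normal (band_chart u) r s =
          cosh \<beta> *\<^sub>R vector [0, 0, 1] + sinh \<beta> *\<^sub>R vector [\<epsilon>, 0, 0]) \<longleftrightarrow>
        deriv u r = \<epsilon> * tanh \<beta>"
    if "u differentiable (at r)" "\<epsilon> = 1 \<or> \<epsilon> = - 1" for r s \<epsilon>
  proof (cases "\<bar>deriv u r\<bar> < 1")
    case True
    then show ?thesis
      using that by (simp add: spacelike_at_band_chart_iff future_unit_normal_band_chart
          normal_angle_iff)
  next
    case False
    then have "deriv u r \<noteq> \<epsilon> * tanh \<beta>" using t that(2) by auto
    then show ?thesis using False that(1) by (simp add: spacelike_at_band_chart_iff)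
  qed
  from this[of a 1] this[of "- a" "- 1"] True show ?thesis
    unfolding makes_contact_angle_def by (auto simp: band_chart_def)
qed (auto simp: makes_contact_angle_def)

end

theory Submission
  imports Defs
begin

text \<open>
  The profile equation \<open>u'' / (1 - u'\<^sup>2) powr (3/2) = \<kappa> u\<close> looks singular at \<open>\<bar>u'\<bar> = 1\<close>, but it is not
  in the variable \<open>v = u' / sqrt (1 - u'\<^sup>2)\<close>, the hyperbolic sine of the inclination angle of the
  profile. The left-hand side is then just \<open>v'\<close>, so \<open>v' = \<kappa> u\<close> and hence
  \<open>v'' = \<kappa> u' = \<kappa> v / sqrt (1 + v\<^sup>2)\<close>. The right-hand side is bounded by \<open>\<kappa>\<close>, odd, and globally
  Lipschitz in \<open>v\<close>. The symmetry condition \<open>u' 0 = 0\<close> becomes \<open>v 0 = 0\<close>, the contact angle condition at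
  \<open>a\<close> becomes \<open>v a = sinh \<beta>\<close>, and the free parameter \<open>u 0\<close> becomes the initial slope \<open>c = v' 0\<close>.

  The theorem is thus a shooting problem. A contraction argument gives, for every \<open>c\<close>, a solution
  \<open>v\<close> on the whole line (\<open>second_order_ivp_exists\<close>). An energy estimate for the difference of two
  solutions shows that \<open>v a\<close> depends continuously on \<open>c\<close> (\<open>energy_estimate\<close>). As \<open>v''\<close> is bounded,
  \<open>v a\<close> differs from \<open>c * a\<close> by a bounded amount, so by the intermediate value theorem it takes every
  value, in particular \<open>sinh \<beta>\<close> (\<open>shooting\<close>). Finally the equation is odd in \<open>v\<close>, so by the same energy
  estimate \<open>v\<close> is odd and \<open>u = v' / \<kappa>\<close> is even; this takes care of the boundary line over \<open>- a\<close>.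
\<close>

section \<open>Comparison estimates for second-order differential inequalities\<close>

lemma abs_le_if_deriv_abs_le:
  fixes F G :: "real \<Rightarrow> real"
  assumes F: "\<And>s. (F has_real_derivative F' s) (at s)"
    and G: "\<And>s. (G has_real_derivative G' s) (at s)"
    and le: "\<And>s. 0 \<le> s \<Longrightarrow> \<bar>F' s\<bar> \<le> G' s"
    and 0: "F 0 = 0" "G 0 = 0" and t: "0 \<le> t"
  shows "\<bar>F t\<bar> \<le> G t"
proof -
  have "G 0 - F 0 \<le> G t - F t"
  proof (rule DERIV_nonneg_imp_nondecreasing[OF t])
    fix s :: real assume "0 \<le> s"
    then have "0 \<le> G' s - F' s" using le[of s] by (simp add: abs_le_iff)
    then show "\<exists>z. ((\<lambda>s. G s - F s) has_real_derivative z) (at s) \<and> 0 \<le> z"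
      using DERIV_diff[OF G F, of s] by blast
  qed
  moreover have "G 0 + F 0 \<le> G t + F t"
  proof (rule DERIV_nonneg_imp_nondecreasing[OF t])
    fix s :: real assume "0 \<le> s"
    then have "0 \<le> G' s + F' s" using le[of s] by (simp add: abs_le_iff)
    then show "\<exists>z. ((\<lambda>s. G s + F s) has_real_derivative z) (at s) \<and> 0 \<le> z"
      using DERIV_add[OF G F, of s] by blast
  qed
  ultimately show ?thesis using 0 by auto
qed

lemma cosh_comparison_nonneg:
  fixes y :: "real \<Rightarrow> real"
  assumes y: "\<And>s. (y has_real_derivative y' s) (at s)"
    and y': "\<And>s. (y' has_real_derivative y'' s) (at s)"
    and 0: "y 0 = 0" "y' 0 = 0" and l: "l > 0"
    and le: "\<And>s. \<bar>y'' s\<bar> \<le> M * cosh (l * s)" and t: "0 \<le> t"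
  shows "\<bar>y t\<bar> \<le> M / l\<^sup>2 * cosh (l * t)"
proof -
  have M: "M \<ge> 0" using le[of 0] by simp
  have 1: "\<bar>y' s\<bar> \<le> M / l * sinh (l * s)" if "s \<ge> 0" for s
  proof (rule abs_le_if_deriv_abs_le[OF y' _ le 0(2) _ that])
    show "((\<lambda>s. M / l * sinh (l * s)) has_real_derivative M * cosh (l * x)) (at x)" for x
      using l by (auto intro!: derivative_eq_intros)
  qed simp
  have "\<bar>y t\<bar> \<le> M / l\<^sup>2 * (cosh (l * t) - 1)"
  proof (rule abs_le_if_deriv_abs_le[OF y _ 1 0(1) _ t])
    show "((\<lambda>s. M / l\<^sup>2 * (cosh (l * s) - 1)) has_real_derivative M / l * sinh (l * x)) (at x)" for x
      using l by (auto intro!: derivative_eq_intros simp: power2_eq_square)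
  qed auto
  also have "\<dots> \<le> M / l\<^sup>2 * cosh (l * t)"
    by (rule mult_left_mono) (use M in auto)
  finally show ?thesis .
qed

text \<open>Integrating \<open>M * cosh (l * t)\<close> twice from \<open>0\<close> gains the factor \<open>1 / l\<^sup>2\<close>: this is what makes the
  Picard operator a contraction in the norm with weight \<open>cosh (l * t)\<close> once \<open>l\<close> is large.\<close>

lemma cosh_comparison:
  fixes y :: "real \<Rightarrow> real"
  assumes y: "\<And>s. (y has_real_derivative y' s) (at s)"
    and y': "\<And>s. (y' has_real_derivative y'' s) (at s)"
    and 0: "y 0 = 0" "y' 0 = 0" and l: "l > 0"
    and le: "\<And>s. \<bar>y'' s\<bar> \<le> M * cosh (l * s)"
  shows "\<bar>y t\<bar> \<le> M / l\<^sup>2 * cosh (l * t)"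
proof (cases "t \<ge> 0")
  case True
  then show ?thesis using cosh_comparison_nonneg[OF y y' 0 l le] by simp
next
  case False
  have "\<bar>y (- (- t))\<bar> \<le> M / l\<^sup>2 * cosh (l * (- t))"
  proof (rule cosh_comparison_nonneg[where y = "\<lambda>s. y (- s)" and y' = "\<lambda>s. - y' (- s)"
        and y'' = "\<lambda>s. y'' (- s)", OF _ _ _ _ l])
    show "((\<lambda>s. y (- s)) has_real_derivative - y' (- s)) (at s)" for s
      using DERIV_mirror[of y "y' (- s)" s] y[of "- s"] by simp
    show "((\<lambda>s. - y' (- s)) has_real_derivative y'' (- s)) (at s)" for s
      using DERIV_minus[of "\<lambda>s. y' (- s)" "- y'' (- s)"] DERIV_mirror[of y' "y'' (- s)" s] y'[of "- s"]
      by simp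
    show "\<bar>y'' (- s)\<bar> \<le> M * cosh (l * s)" for s using le[of "- s"] by simp
  qed (use 0 False in auto)
  then show ?thesis by simp
qed

text \<open>The energy \<open>k\<^sup>2 * y\<^sup>2 + y'\<^sup>2\<close> grows at most with rate \<open>2 * k\<close>. Applied to the difference of two
  solutions of the same Lipschitz equation, this gives uniqueness (\<open>y' 0 = 0\<close>) and continuous
  dependence on the initial slope.\<close>

lemma energy_estimate:
  fixes y :: "real \<Rightarrow> real"
  assumes y: "\<And>s. (y has_real_derivative y' s) (at s)"
    and y': "\<And>s. (y' has_real_derivative y'' s) (at s)"
    and 0: "y 0 = 0" and k: "k > 0"
    and le: "\<And>s. \<bar>y'' s\<bar> \<le> k\<^sup>2 * \<bar>y s\<bar>" and t: "0 \<le> t"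
  shows "\<bar>y t\<bar> \<le> \<bar>y' 0\<bar> * exp (k * t) / k"
proof -
  define E where "E s = k\<^sup>2 * (y s)\<^sup>2 + (y' s)\<^sup>2" for s
  have "E t * exp (- 2 * k * t) \<le> E 0 * exp (- 2 * k * 0)"
  proof (rule DERIV_nonpos_imp_nonincreasing[OF t])
    fix s
    have "(E has_real_derivative (2 * k\<^sup>2 * y s * y' s + 2 * y' s * y'' s)) (at s)"
      unfolding E_def by (auto intro!: derivative_eq_intros y y')
    then have D: "((\<lambda>s. E s * exp (- 2 * k * s)) has_real_derivative
        (2 * k\<^sup>2 * y s * y' s + 2 * y' s * y'' s - 2 * k * E s) * exp (- 2 * k * s)) (at s)"
      by (auto intro!: derivative_eq_intros simp: algebra_simps)
    have a: "y' s * y'' s \<le> \<bar>y' s\<bar> * (k\<^sup>2 * \<bar>y s\<bar>)"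
      using mult_left_mono[OF le[of s], of "\<bar>y' s\<bar>"] abs_ge_self[of "y' s * y'' s"]
      by (simp add: abs_mult)
    have b: "k\<^sup>2 * y s * y' s \<le> \<bar>y' s\<bar> * (k\<^sup>2 * \<bar>y s\<bar>)"
      using abs_ge_self[of "k\<^sup>2 * y s * y' s"] by (simp add: abs_mult mult_ac)
    have "0 \<le> 2 * k * (k * \<bar>y s\<bar> - \<bar>y' s\<bar>)\<^sup>2" using k by simp
    also have "\<dots> = 2 * k * E s - 4 * (\<bar>y' s\<bar> * (k\<^sup>2 * \<bar>y s\<bar>))"
      unfolding E_def power2_diff power_mult_distrib power2_abs
      by (simp add: algebra_simps power2_eq_square)
    finally have "2 * k\<^sup>2 * y s * y' s + 2 * y' s * y'' s - 2 * k * E s \<le> 0"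
      using a b by linarith
    then show "\<exists>z. ((\<lambda>s. E s * exp (- 2 * k * s)) has_real_derivative z) (at s) \<and> z \<le> 0"
      using D by (intro exI conjI) (auto intro: mult_nonpos_nonneg)
  qed
  then have "E t \<le> (y' 0)\<^sup>2 * exp (2 * (k * t))"
    by (simp add: E_def 0 exp_minus field_simps)
  then have "(k * y t)\<^sup>2 \<le> (\<bar>y' 0\<bar> * exp (k * t))\<^sup>2"
    by (simp add: E_def power_mult_distrib exp_double) (smt (verit) zero_le_power2)
  then have "\<bar>k * y t\<bar> \<le> \<bar>y' 0\<bar> * exp (k * t)" by (rule abs_le_square_iff[THEN iffD2, THEN order_trans]) simp
  then show ?thesis using k by (simp add: abs_mult field_simps)
qed


section \<open>Global solutions of second-order Lipschitz equations\<close>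

definition primitive :: "(real \<Rightarrow> real) \<Rightarrow> real \<Rightarrow> real" where
  "primitive f = (SOME F. F 0 = 0 \<and> (\<forall>t. (F has_real_derivative f t) (at t)))"

lemma primitive:
  assumes "continuous_on UNIV f"
  shows "primitive f 0 = 0" "(primitive f has_real_derivative f t) (at t)"
proof -
  have "\<exists>F. \<forall>x::real. - \<infinity> < ereal x \<longrightarrow> ereal x < \<infinity> \<longrightarrow> (F has_vector_derivative f x) (at x)"
    by (rule einterval_antiderivative)
       (use assms in \<open>auto simp: continuous_on_eq_continuous_at\<close>)
  then obtain F where F: "(F has_real_derivative f x) (at x)" for x
    by (auto simp: has_real_derivative_iff_has_vector_derivative)
  have "\<exists>F. F 0 = 0 \<and> (\<forall>t. (F has_real_derivative f t) (at t))"
    by (rule exI[of _ "\<lambda>t. F t - F 0"]) (auto intro!: derivative_eq_intros F)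
  from someI_ex[OF this]
  show "primitive f 0 = 0" "(primitive f has_real_derivative f t) (at t)"
    unfolding primitive_def by blast+
qed

lemma abs_le_2_cosh: "\<bar>x\<bar> \<le> 2 * cosh (x::real)"
proof -
  have "\<bar>x\<bar> \<le> exp \<bar>x\<bar>" using exp_ge_add_one_self[of "\<bar>x\<bar>"] by linarith
  also have "\<dots> \<le> 2 * cosh \<bar>x\<bar>" by (simp add: cosh_def)
  finally show ?thesis by simp
qed

text \<open>Solutions of a Lipschitz equation grow at most exponentially, so the quotient \<open>w = v / cosh (l * t)\<close>
  is sought in the Banach space of bounded continuous functions on the whole line. There the
  twice integrated equation is a fixed-point problem, with contraction constant
  \<open>L / l\<^sup>2 = 1 / 2\<close> for the choice \<open>l = sqrt (2 * L)\<close>.\<close>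

lemma second_order_ivp_exists:
  fixes f :: "real \<Rightarrow> real"
  assumes lip: "L-lipschitz_on UNIV f" and L: "L > 0"
  obtains v v' where "v 0 = p" "v' 0 = q"
    "\<And>t. (v has_real_derivative v' t) (at t)"
    "\<And>t. (v' has_real_derivative f (v t)) (at t)"
proof -
  define l where "l = sqrt (2 * L)"
  have l: "l > 0" "l\<^sup>2 = 2 * L" using L by (auto simp: l_def)
  have c1: "cosh (l * t) \<ge> 1" for t by (rule cosh_real_ge_1)
  have c0: "cosh (l * t) > 0" for t by (rule cosh_real_pos)
  define v where "v w t = apply_bcontfun w t * cosh (l * t)" for w t
  define I where "I w = primitive (\<lambda>t. f (v w t))" for w
  define J where "J w = primitive (I w)" for w
  define T where "T w t = (p + q * t + J w t) / cosh (l * t)" for w t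
  have "continuous_on UNIV f" using lip by (rule lipschitz_on_continuous_on)
  then have cf: "continuous_on UNIV (\<lambda>t. f (v w t))" for w
    by (rule continuous_on_compose2[where t = UNIV])
       (auto intro!: continuous_intros simp: v_def)
  note I = primitive[OF cf, folded I_def]
  have cI: "continuous_on UNIV (I w)" for w
    by (rule DERIV_continuous_on) (rule I(2)[THEN DERIV_subset], simp)
  note J = primitive[OF cI, folded J_def]

  have fb: "\<bar>f (v w s)\<bar> \<le> (\<bar>f 0\<bar> + L * norm w) * cosh (l * s)" for w s
  proof -
    have "\<bar>f (v w s)\<bar> \<le> \<bar>f 0\<bar> + L * \<bar>v w s\<bar>"
      using lipschitz_onD[OF lip, of "v w s" 0] by (simp add: dist_real_def)
    also have "\<dots> = \<bar>f 0\<bar> * 1 + L * (\<bar>apply_bcontfun w s\<bar> * cosh (l * s))"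
      using c0 by (simp add: v_def abs_mult)
    also have "\<dots> \<le> \<bar>f 0\<bar> * cosh (l * s) + L * (norm w * cosh (l * s))"
      using norm_bounded[of w s] c0[of s] c1[of s] L
      by (intro add_mono mult_left_mono mult_right_mono) auto
    finally show ?thesis by (simp add: algebra_simps)
  qed
  have Tb: "T w \<in> bcontfun" for w
  proof (rule bcontfun_normI)
    have "continuous_on UNIV (J w)"
      by (rule DERIV_continuous_on) (rule J(2)[THEN DERIV_subset], simp)
    then show "continuous_on UNIV (T w)"
      unfolding T_def by (intro continuous_intros) (use c0 in \<open>auto simp: less_le\<close>)
    fix t
    let ?M = "(\<bar>f 0\<bar> + L * norm w) / l\<^sup>2"
    have "\<bar>J w t\<bar> \<le> ?M * cosh (l * t)"
      by (rule cosh_comparison[OF J(2) I(2) J(1) I(1) l(1) fb])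
    moreover have "\<bar>p\<bar> \<le> \<bar>p\<bar> * cosh (l * t)" using c1[of t] by (simp add: mult_le_cancel_left1)
    moreover have "\<bar>q * t\<bar> \<le> \<bar>q\<bar> * 2 / l * cosh (l * t)"
      using mult_left_mono[OF abs_le_2_cosh[of "l * t"], of "\<bar>q\<bar>"] l(1)
      by (simp add: abs_mult field_simps)
    ultimately have "\<bar>p + q * t + J w t\<bar> \<le> (\<bar>p\<bar> + \<bar>q\<bar> * 2 / l + ?M) * cosh (l * t)"
      unfolding distrib_right by linarith
    then show "norm (T w t) \<le> \<bar>p\<bar> + \<bar>q\<bar> * 2 / l + ?M"
      using c0[of t] by (simp add: T_def abs_divide pos_divide_le_eq)
  qed
  have contr: "dist (Bcontfun (T w)) (Bcontfun (T z)) \<le> 1/2 * dist w z" for w z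
  proof (rule dist_bound)
    fix t
    have "\<bar>J w t - J z t\<bar> \<le> (L * dist w z) / l\<^sup>2 * cosh (l * t)"
    proof (rule cosh_comparison[OF DERIV_diff[OF J(2) J(2)] DERIV_diff[OF I(2) I(2)] _ _ l(1)])
      fix s
      have "\<bar>f (v w s) - f (v z s)\<bar> \<le> L * \<bar>v w s - v z s\<bar>"
        using lipschitz_onD[OF lip, of "v w s" "v z s"] by (simp add: dist_real_def)
      also have "\<dots> = L * dist (apply_bcontfun w s) (apply_bcontfun z s) * cosh (l * s)"
        using c0[of s] by (simp add: v_def dist_real_def abs_mult flip: left_diff_distrib)
      also have "\<dots> \<le> L * dist w z * cosh (l * s)"
        using dist_bounded[of w s z] L c0[of s] by (intro mult_right_mono mult_left_mono) auto
      finally show "\<bar>f (v w s) - f (v z s)\<bar> \<le> L * dist w z * cosh (l * s)" .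
    qed (simp_all add: I J)
    then have "\<bar>J w t - J z t\<bar> / cosh (l * t) \<le> 1/2 * dist w z"
      using L l c0[of t] by (simp add: pos_divide_le_eq)
    then show "dist (apply_bcontfun (Bcontfun (T w)) t) (apply_bcontfun (Bcontfun (T z)) t)
        \<le> 1/2 * dist w z"
      using c0[of t]
      by (simp add: Bcontfun_inverse[OF Tb] T_def dist_real_def abs_divide flip: diff_divide_distrib)
  qed
  obtain w where w: "Bcontfun (T w) = w"
    using banach_fix_type[of "1/2" "\<lambda>w. Bcontfun (T w)"] contr by auto
  have vw: "v w = (\<lambda>t. p + q * t + J w t)"
  proof
    fix t
    have "apply_bcontfun w t = T w t" using Bcontfun_inverse[OF Tb, of w] w by simp
    then show "v w t = p + q * t + J w t" using c0[of t] by (simp add: v_def T_def)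
  qed
  show thesis
  proof (rule that[of "v w" "\<lambda>t. q + I w t"])
    show "v w 0 = p" "q + I w 0 = q" by (simp_all add: vw J I)
    show "(v w has_real_derivative q + I w t) (at t)" for t
      unfolding vw by (auto intro!: derivative_eq_intros J)
    show "((\<lambda>t. q + I w t) has_real_derivative f (v w t)) (at t)" for t
      by (auto intro!: derivative_eq_intros I)
  qed
qed


section \<open>Shooting\<close>

text \<open>The difference of two solutions satisfies \<open>energy_estimate\<close>, so the end value is a Lipschitz
  function of the slope \<open>c\<close>; comparison with \<open>c * a\<close>, where the solution would end without the
  bounded force \<open>f\<close>, shows that it is unbounded in both directions.\<close>

lemma shooting:
  fixes f :: "real \<Rightarrow> real"
  assumes lip: "L-lipschitz_on UNIV f" and L: "L > 0" and bdd: "\<And>x. \<bar>f x\<bar> \<le> B" and a: "a > 0"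
  obtains v v' where "v 0 = 0" "v a = b"
    "\<And>t. (v has_real_derivative v' t) (at t)"
    "\<And>t. (v' has_real_derivative f (v t)) (at t)"
proof -
  have "\<exists>v v'. v 0 = 0 \<and> v' 0 = c \<and> (\<forall>t. (v has_real_derivative v' t) (at t)) \<and>
      (\<forall>t. (v' has_real_derivative f (v t)) (at t))" for c
    by (rule second_order_ivp_exists[OF lip L, of 0 c]) blast
  then obtain V V' where V: "V c 0 = 0" "V' c 0 = c" "(V c has_real_derivative V' c t) (at t)"
    "(V' c has_real_derivative f (V c t)) (at t)" for c t
    by metis
  define k where "k = sqrt L"
  have k: "k > 0" "k\<^sup>2 = L" using L by (auto simp: k_def)
  have diff: "\<bar>V c a - V d a\<bar> \<le> exp (k * a) / k * \<bar>c - d\<bar>" for c d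
  proof -
    have "\<bar>f (V c s) - f (V d s)\<bar> \<le> k\<^sup>2 * \<bar>V c s - V d s\<bar>" for s
      using lipschitz_onD[OF lip, of "V c s" "V d s"] by (simp add: k dist_real_def)
    from energy_estimate[OF DERIV_diff[OF V(3) V(3)] DERIV_diff[OF V(4) V(4)] _ k(1) this, of a]
    show ?thesis using a by (simp add: V mult_ac)
  qed
  have "(exp (k * a) / k)-lipschitz_on UNIV (\<lambda>c. V c a)"
    by (rule lipschitz_onI) (use diff k in \<open>auto simp: dist_real_def\<close>)
  then have cont: "continuous_on UNIV (\<lambda>c. V c a)" by (rule lipschitz_on_continuous_on)
  have near: "\<bar>V c a - c * a\<bar> \<le> B * cosh a" for c
  proof -
    have "\<bar>V c a - c * a\<bar> \<le> B / 1\<^sup>2 * cosh (1 * a)"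
    proof (rule cosh_comparison[where y' = "\<lambda>t. V' c t - c" and y'' = "\<lambda>t. f (V c t)"])
      show "((\<lambda>a. V c a - c * a) has_real_derivative V' c s - c) (at s)" for s
        by (auto intro!: derivative_eq_intros V)
      show "((\<lambda>t. V' c t - c) has_real_derivative f (V c s)) (at s)" for s
        by (auto intro!: derivative_eq_intros V)
      have "B \<ge> 0" using bdd[of 0] by linarith
      then have "B * 1 \<le> B * cosh (1 * s)" for s
        by (intro mult_left_mono cosh_real_ge_1)
      then show "\<bar>f (V c s)\<bar> \<le> B * cosh (1 * s)" for s
        using order_trans[OF bdd] by simp
    qed (simp_all add: V)
    then show ?thesis by simp
  qed
  define R where "R = (\<bar>b\<bar> + B * cosh a) / a"
  have "B \<ge> 0" using bdd[of 0] by linarith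
  then have R: "R \<ge> 0" "R * a = \<bar>b\<bar> + B * cosh a"
    using a by (auto simp: R_def intro!: divide_nonneg_pos add_nonneg_nonneg)
  have "V (- R) a \<le> b" "b \<le> V R a"
    using near[of R] near[of "- R"] R by (auto simp: abs_le_iff)
  then obtain c where "V c a = b"
    using IVT'[of "\<lambda>c. V c a" "- R" b R] R(1) continuous_on_subset[OF cont] by auto
  then show thesis using that[of "V c" "V' c"] V by blast
qed

text \<open>If \<open>f\<close> is odd then \<open>- v (- t)\<close> solves the same equation with the same initial data.\<close>

lemma odd_solution:
  fixes f :: "real \<Rightarrow> real"
  assumes lip: "L-lipschitz_on UNIV f" and L: "L > 0" and odd: "\<And>x. f (- x) = - f x"
    and v: "\<And>t. (v has_real_derivative v' t) (at t)"
    and v': "\<And>t. (v' has_real_derivative f (v t)) (at t)"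
    and v0: "v 0 = 0" and t: "t \<ge> 0"
  shows "v (- t) = - v t"
proof -
  define k where "k = sqrt L"
  have k: "k > 0" "k\<^sup>2 = L" using L by (auto simp: k_def)
  have "\<bar>v t + v (- t)\<bar> \<le> \<bar>v' 0 - v' (- 0)\<bar> * exp (k * t) / k"
  proof (rule energy_estimate[where y'' = "\<lambda>t. f (v t) + f (v (- t))", OF _ _ _ k(1) _ t])
    show "((\<lambda>t. v t + v (- t)) has_real_derivative v' s - v' (- s)) (at s)" for s
      using DERIV_add[OF v[of s], of "\<lambda>s. v (- s)" "- v' (- s)"] DERIV_mirror[of v "v' (- s)" s] v[of "- s"] by simp
    show "((\<lambda>t. v' t - v' (- t)) has_real_derivative f (v s) + f (v (- s))) (at s)" for s
      using DERIV_diff[OF v'[of s], of "\<lambda>s. v' (- s)" "- f (v (- s))"] DERIV_mirror[of v' "f (v (- s))" s] v'[of "- s"]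
      by simp
    show "\<bar>f (v s) + f (v (- s))\<bar> \<le> k\<^sup>2 * \<bar>v s + v (- s)\<bar>" for s
      using lipschitz_onD[OF lip, of "v s" "- v (- s)"] by (simp add: k odd dist_real_def)
  qed (simp add: v0)
  then show ?thesis by simp
qed


section \<open>The slope as a function of the hyperbolic sine of the inclination\<close>

definition slope :: "real \<Rightarrow> real" where
  "slope x = x / sqrt (1 + x\<^sup>2)"

lemma one_plus_square_pos: "0 < 1 + (x::real)\<^sup>2"
  by (simp add: add_pos_nonneg)

lemma slope_has_derivative:
  "(slope has_real_derivative 1 / sqrt (1 + x\<^sup>2) ^ 3) (at x)"
proof -
  define r where "r = sqrt (1 + x\<^sup>2)"
  have r: "r > 0" "r\<^sup>2 = 1 + x\<^sup>2" using one_plus_square_pos[of x] by (auto simp: r_def)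
  have "(slope has_real_derivative (r - x * (x / r)) / (r * r)) (at x)"
    unfolding slope_def r_def using one_plus_square_pos[of x]
    by (auto intro!: derivative_eq_intros simp: field_simps)
  also have "(r - x * (x / r)) / (r * r) = (r\<^sup>2 - x\<^sup>2) / r ^ 3"
    using r(1) by (simp add: field_simps power2_eq_square power3_eq_cube)
  finally show ?thesis using r by (simp add: r_def)
qed

lemma one_minus_slope_square: "1 - (slope x)\<^sup>2 = 1 / (1 + x\<^sup>2)"
  using one_plus_square_pos[of x] by (simp add: slope_def power_divide field_simps)

lemma abs_slope_less_1: "\<bar>slope x\<bar> < 1"
proof -
  have "1 - (slope x)\<^sup>2 > 0" unfolding one_minus_slope_square using one_plus_square_pos[of x] by simp
  then show ?thesis by (simp add: abs_square_less_1)
qed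

lemma one_minus_slope_square_powr:
  "(1 - (slope x)\<^sup>2) powr (3/2) = 1 / sqrt (1 + x\<^sup>2) ^ 3"
proof -
  have "sqrt (1 + x\<^sup>2) ^ 3 = (1 + x\<^sup>2) powr (3/2)"
    using one_plus_square_pos[of x]
    by (simp add: powr_powr powr_half_sqrt[symmetric] flip: powr_realpow)
  then show ?thesis
    unfolding one_minus_slope_square using one_plus_square_pos[of x] by (simp add: powr_divide)
qed

lemma slope_sinh: "slope (sinh \<beta>) = tanh \<beta>"
proof -
  have "sqrt (1 + (sinh \<beta>)\<^sup>2) = cosh \<beta>"
    using cosh_square_eq[of \<beta>] cosh_real_pos[of \<beta>] by (intro real_sqrt_unique) auto
  then show ?thesis by (simp add: slope_def tanh_def)
qed

lemma slope_minus: "slope (- x) = - slope x"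
  by (simp add: slope_def)

lemma lipschitz_slope: "1-lipschitz_on UNIV slope"
proof (rule lipschitz_onI)
  fix x y :: real
  have "1 / sqrt (1 + z\<^sup>2) ^ 3 \<le> 1" for z :: real
  proof -
    have "1 \<le> sqrt (1 + z\<^sup>2) ^ 3" by (rule one_le_power) simp
    then show ?thesis by (metis divide_le_eq_1_pos less_le_trans zero_less_one)
  qed
  then have "norm (slope x - slope y) \<le> 1 * norm (x - y)"
    by (intro field_differentiable_bound[of UNIV slope "\<lambda>z. 1 / sqrt (1 + z\<^sup>2) ^ 3"])
       (auto intro: slope_has_derivative)
  then show "dist (slope x) (slope y) \<le> 1 * dist x y" by (simp add: dist_real_def)
qed simp


section \<open>Existence of the stationary band\<close>

theorem theorem4p3:
  fixes a \<kappa> \<beta> :: real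
  assumes "a > 0" and "\<kappa> > 0"
  shows "\<exists>S u0 u. is_profile \<kappa> u0 u \<and> stationary_band \<kappa> a u S \<and> makes_contact_angle a u \<beta>"
proof -
  define f where "f x = \<kappa> * slope x" for x
  have lip: "\<kappa>-lipschitz_on UNIV f"
  proof (rule lipschitz_onI)
    show "dist (f x) (f y) \<le> \<kappa> * dist x y" for x y
      using lipschitz_onD[OF lipschitz_slope, of x y] assms(2)
      by (simp add: f_def dist_real_def abs_mult flip: right_diff_distrib)
  qed (use assms(2) in simp)
  have bdd: "\<bar>f x\<bar> \<le> \<kappa>" for x
    using abs_slope_less_1[of x] assms(2) by (simp add: f_def abs_mult mult_le_cancel_left2)
  obtain v v' where v0: "v 0 = 0" and va: "v a = sinh \<beta>"
    and v: "\<And>t. (v has_real_derivative v' t) (at t)"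
    and v': "\<And>t. (v' has_real_derivative f (v t)) (at t)"
    using shooting[OF lip assms(2) bdd assms(1)] by metis
  have odd: "v (- t) = - v t" if "t \<ge> 0" for t
    using odd_solution[OF lip assms(2) _ v v' v0 that] by (simp add: f_def slope_minus)

  define u where "u t = v' t / \<kappa>" for t
  have u: "(u has_real_derivative slope (v t)) (at t)" for t
    unfolding u_def using assms(2) by (auto intro!: derivative_eq_intros v' simp: f_def)
  have u': "deriv u = (\<lambda>t. slope (v t))" using u by (auto intro: DERIV_imp_deriv)
  have d2: "(deriv u has_real_derivative \<kappa> * u t / sqrt (1 + (v t)\<^sup>2) ^ 3) (at t)" for t
    unfolding u' using DERIV_chain2[OF slope_has_derivative v, of t] assms(2) by (simp add: u_def)
  have u'': "deriv (deriv u) = (\<lambda>t. \<kappa> * u t / sqrt (1 + (v t)\<^sup>2) ^ 3)"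
    using d2 by (auto intro: DERIV_imp_deriv)
  have diff: "u differentiable (at t)" "deriv u differentiable (at t)" for t
    using u d2 real_differentiable_def by blast+

  have ode: "\<bar>deriv u r\<bar> < 1 \<and>
      deriv (deriv u) r / (1 - (deriv u r)\<^sup>2) powr (3/2) = \<kappa> * u r" for r
  proof -
    have "sqrt (1 + (v r)\<^sup>2) ^ 3 > 0" using one_plus_square_pos by simp
    then show ?thesis
      unfolding u'' unfolding u' one_minus_slope_square_powr using abs_slope_less_1 by simp
  qed
  have "is_profile \<kappa> (u 0) u"
    using diff ode by (simp add: is_profile_def) (simp add: u' v0 slope_def)
  moreover have "C2_on {- a <..< a} u"
  proof -
    have "continuous_on UNIV u" "continuous_on UNIV v"
      by (auto intro!: DERIV_continuous_on u[THEN DERIV_subset] v[THEN DERIV_subset])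
    then have "continuous_on {- a <..< a} u" "continuous_on {- a <..< a} v"
      by (auto intro: continuous_on_subset)
    moreover have "sqrt (1 + (v t)\<^sup>2) ^ 3 \<noteq> 0" for t
      using one_plus_square_pos[of "v t"] by simp
    ultimately show ?thesis
      unfolding C2_on_def using diff by (auto simp: u'' intro!: continuous_intros)
  qed
  then have "stationary_band \<kappa> a u (band a u)"
    using ode by (simp add: stationary_band_iff)
  moreover have "u (- a) = u a"
  proof -
    have "\<bar>u (- a) - u a\<bar> \<le> 0"
    proof (rule abs_le_if_deriv_abs_le[where G = "\<lambda>_. 0" and G' = "\<lambda>_. 0"
          and F = "\<lambda>t. u (- t) - u t" and F' = "\<lambda>t. - slope (v (- t)) - slope (v t)"])
      show "((\<lambda>t. u (- t) - u t) has_real_derivative - slope (v (- s)) - slope (v s)) (at s)" for s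
        using DERIV_diff[OF _ u[of s], of "\<lambda>s. u (- s)" "- slope (v (- s))"]
          DERIV_mirror[of u "slope (v (- s))" s] u[of "- s"] by simp
    qed (use assms(1) in \<open>auto simp: odd slope_minus\<close>)
    then show ?thesis by simp
  qed
  then have "makes_contact_angle a u \<beta>"
    using diff assms(1)
    by (simp add: makes_contact_angle_iff u' va odd slope_minus slope_sinh)
  ultimately show ?thesis by blast
qed

end
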